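(* Let $f$ be a slice regular function on a slice domain $\Omega\subseteq\mathbb{H}$ and let $J_0\in\mathbb{S}$. Let $\mathcal{C}$ be an (axially) symmetric, compact and path-connected subset of $\mathbb{H}$ such that $\emptyset\neq\mathcal{C}_{J_0}^+\subset\Omega_{J_0}^+$. If $\mathcal{C}\cap\mathbb{R}$ is not empty, suppose it is a closed interval included in $\Omega$. Then there exist an extension triplet $\big(\widetilde f,N,\Lambda\big)$ for $f$ and a real number $\delta>0$ such that $$\bigcup_{J\in\mathbb{S},\,|J-J_0|\leq\delta}\overline{\mathcal{C}_J^+}\subset\Lambda .$$ In particular, $\widetilde f$ coincides with $f$ in a neighborhood of $\overline{\mathcal{C}_{J_0}^+}$.
   Context: $\mathbb{H}$ is the real algebra of quaternions and $\mathbb{S}=\{J\in\mathbb{H}:J^2=-1\}$. For $I\in\mathbb{S}$: $L_I=\mathbb{R}+I\mathbb{R}$ and $L_I^+=\{x+yI: x,y\in\mathbb{R},\,y>0\}$; for $T\subseteq\mathbb{H}$, $T_I=T\cap L_I$ and $T_I^+=T\cap L_I^+$. A set $T\subseteq\mathbb{H}$ is (axially) symmetric if, whenever $x+yI\in T$ with $x,y\in\mathbb{R}$, $I\in\mathbb{S}$, the whole set $x+y\mathbb{S}=\{x+yJ:J\in\mathbb{S}\}$ is contained in $T$. A domain is a nonempty open connected set. A slice domain is a domain $\Omega\subseteq\mathbb{H}$ with $\Omega\cap\mathbb{R}\neq\emptyset$ such that $\Omega_I$ is a domain of $L_I$ for every $I\in\mathbb{S}$; a symmetric slice domain is a slice domain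 that is symmetric. A function $f:\Omega\to\mathbb{H}$ is slice regular if, for every $I\in\mathbb{S}$, the restriction $f_I$ of $f$ to $\Omega_I$ has continuous partial derivatives and $\frac12\left(\frac{\partial}{\partial x}+I\frac{\partial}{\partial y}\right)f_I(x+yI)\equiv0$ on $\Omega_I$. Extension triplet: for a slice regular $f$ on a slice domain $\Omega$, a triplet $\big(\widetilde f,N,\Lambda\big)$ is an extension triplet for $f$ if $N$ is a symmetric slice domain with $N\cap\mathbb{R}\subset\Omega$, $\widetilde f:N\to\mathbb{H}$ is slice regular, and $\Lambda\subseteq\Omega\cap N$ is a slice domain where $f$ and $\widetilde f$ coincide. *)

theory Defs
  imports "HOL-Analysis.Analysis"
begin

section \<open>The normed division algebra of quaternions\<close>

text \<open>\<open>Quat a b c d\<close> is \<open>a + b i + c j + d k\<close>.\<close>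

datatype quat = Quat (qRe: real) (qI: real) (qJ: real) (qK: real)

lemma quat_eq_iff:
  "p = q \<longleftrightarrow> qRe p = qRe q \<and> qI p = qI q \<and> qJ p = qJ q \<and> qK p = qK q"
  by (cases p; cases q) simp

instantiation quat :: real_vector
begin

definition zero_quat :: quat where "0 = Quat 0 0 0 0"

definition plus_quat :: "quat \<Rightarrow> quat \<Rightarrow> quat" where
  "p + q = Quat (qRe p + qRe q) (qI p + qI q) (qJ p + qJ q) (qK p + qK q)"

definition uminus_quat :: "quat \<Rightarrow> quat" where
  "- p = Quat (- qRe p) (- qI p) (- qJ p) (- qK p)"

definition minus_quat :: "quat \<Rightarrow> quat \<Rightarrow> quat" where
  "p - q = Quat (qRe p - qRe q) (qI p - qI q) (qJ p - qJ q) (qK p - qK q)"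

definition scaleR_quat :: "real \<Rightarrow> quat \<Rightarrow> quat" where
  "r *\<^sub>R p = Quat (r * qRe p) (r * qI p) (r * qJ p) (r * qK p)"

instance
  by standard
    (simp_all add: quat_eq_iff zero_quat_def plus_quat_def uminus_quat_def minus_quat_def
      scaleR_quat_def algebra_simps)

end

lemma quat_sel_linear [simp]:
  "qRe 0 = 0" "qI 0 = 0" "qJ 0 = 0" "qK 0 = 0"
  "qRe (p + q) = qRe p + qRe q" "qI (p + q) = qI p + qI q"
  "qJ (p + q) = qJ p + qJ q" "qK (p + q) = qK p + qK q"
  "qRe (- p) = - qRe p" "qI (- p) = - qI p" "qJ (- p) = - qJ p" "qK (- p) = - qK p"
  "qRe (p - q) = qRe p - qRe q" "qI (p - q) = qI p - qI q"
  "qJ (p - q) = qJ p - qJ q" "qK (p - q) = qK p - qK q"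
  "qRe (r *\<^sub>R p) = r * qRe p" "qI (r *\<^sub>R p) = r * qI p"
  "qJ (r *\<^sub>R p) = r * qJ p" "qK (r *\<^sub>R p) = r * qK p"
  by (simp_all add: zero_quat_def plus_quat_def uminus_quat_def minus_quat_def scaleR_quat_def)

instantiation quat :: real_inner
begin

definition inner_quat :: "quat \<Rightarrow> quat \<Rightarrow> real" where
  "inner_quat p q = qRe p * qRe q + qI p * qI q + qJ p * qJ q + qK p * qK q"

definition norm_quat :: "quat \<Rightarrow> real" where
  "norm_quat p = sqrt (inner p p)"

definition dist_quat :: "quat \<Rightarrow> quat \<Rightarrow> real" where
  "dist_quat p q = norm (p - q)"

definition sgn_quat :: "quat \<Rightarrow> quat" where
  "sgn_quat p = p /\<^sub>R norm p"

definition uniformity_quat :: "(quat \<times> quat) filter" where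
  "uniformity_quat = (INF e\<in>{0 <..}. principal {(p :: quat, q). dist p q < e})"

definition open_quat :: "quat set \<Rightarrow> bool" where
  "open_quat U \<longleftrightarrow> (\<forall>p\<in>U. eventually (\<lambda>(p', q). p' = p \<longrightarrow> q \<in> U) uniformity)"

instance
proof
  fix p q s :: quat and r :: real and U :: "quat set"
  show "dist p q = norm (p - q)" by (rule dist_quat_def)
  show "sgn p = p /\<^sub>R norm p" by (rule sgn_quat_def)
  show "uniformity = (INF e\<in>{0 <..}. principal {(p :: quat, q). dist p q < e})"
    by (rule uniformity_quat_def)
  show "open U \<longleftrightarrow> (\<forall>p\<in>U. eventually (\<lambda>(p', q). p' = p \<longrightarrow> q \<in> U) uniformity)"
    by (rule open_quat_def)
  show "inner p q = inner q p" by (simp add: inner_quat_def algebra_simps)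
  show "inner (p + q) s = inner p s + inner q s" by (simp add: inner_quat_def algebra_simps)
  show "inner (r *\<^sub>R p) q = r * inner p q" by (simp add: inner_quat_def algebra_simps)
  show "0 \<le> inner p p" by (simp add: inner_quat_def)
  show "inner p p = 0 \<longleftrightarrow> p = 0"
    by (simp add: inner_quat_def quat_eq_iff add_nonneg_eq_0_iff)
  show "norm p = sqrt (inner p p)" by (rule norm_quat_def)
qed

end

lemma norm_quat_squared: "(norm p)\<^sup>2 = (qRe p)\<^sup>2 + (qI p)\<^sup>2 + (qJ p)\<^sup>2 + (qK p)\<^sup>2"
  unfolding power2_norm_eq_inner inner_quat_def by (simp add: power2_eq_square)

instantiation quat :: euclidean_space
begin

definition Basis_quat :: "quat set" where
  "Basis = {Quat 1 0 0 0, Quat 0 1 0 0, Quat 0 0 1 0, Quat 0 0 0 1}"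

instance
proof
  fix p q :: quat
  show "(Basis :: quat set) \<noteq> {}" "finite (Basis :: quat set)"
    by (simp_all add: Basis_quat_def)
  show "inner p q = (if p = q then 1 else 0)" if "p \<in> Basis" "q \<in> Basis"
    using that unfolding Basis_quat_def by (elim insertE emptyE) (simp_all add: inner_quat_def)
  show "(\<forall>u\<in>Basis. inner p u = 0) \<longleftrightarrow> p = 0"
    by (cases p) (simp add: Basis_quat_def inner_quat_def zero_quat_def)
qed

end

instantiation quat :: real_normed_div_algebra
begin

definition one_quat :: quat where "1 = Quat 1 0 0 0"

text \<open>The bilinear product determined by \<open>i\<^sup>2 = j\<^sup>2 = k\<^sup>2 = i j k = -1\<close>.\<close>

definition times_quat :: "quat \<Rightarrow> quat \<Rightarrow> quat" where
  "p * q = Quat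
    (qRe p * qRe q - qI p * qI q - qJ p * qJ q - qK p * qK q)
    (qRe p * qI q + qI p * qRe q + qJ p * qK q - qK p * qJ q)
    (qRe p * qJ q - qI p * qK q + qJ p * qRe q + qK p * qI q)
    (qRe p * qK q + qI p * qJ q - qJ p * qI q + qK p * qRe q)"

definition inverse_quat :: "quat \<Rightarrow> quat" where
  "inverse p = Quat (qRe p) (- qI p) (- qJ p) (- qK p) /\<^sub>R (norm p)\<^sup>2"

definition divide_quat :: "quat \<Rightarrow> quat \<Rightarrow> quat" where
  "divide_quat p q = p * inverse q"

instance
proof
  fix p q s :: quat and r :: real
  show "p * q * s = p * (q * s)" by (simp add: times_quat_def algebra_simps)
  show "1 * p = p" by (simp add: times_quat_def one_quat_def)
  show "p * 1 = p" by (simp add: times_quat_def one_quat_def)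
  show "(p + q) * s = p * s + q * s" by (simp add: times_quat_def quat_eq_iff algebra_simps)
  show "p * (q + s) = p * q + p * s" by (simp add: times_quat_def quat_eq_iff algebra_simps)
  show "(0 :: quat) \<noteq> 1" by (simp add: one_quat_def zero_quat_def)
  show "r *\<^sub>R p * q = r *\<^sub>R (p * q)" by (simp add: times_quat_def quat_eq_iff algebra_simps)
  show "p * r *\<^sub>R q = r *\<^sub>R (p * q)" by (simp add: times_quat_def quat_eq_iff algebra_simps)
  show "p div q = p * inverse q" by (rule divide_quat_def)
  show "inverse (0 :: quat) = 0" by (simp add: inverse_quat_def)
  have scale_left: "t *\<^sub>R u * v = t *\<^sub>R (u * v)" and
    scale_right: "u * t *\<^sub>R v = t *\<^sub>R (u * v)" for t and u v :: quat
    by (simp_all add: times_quat_def quat_eq_iff algebra_simps)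
  let ?conj = "Quat (qRe p) (- qI p) (- qJ p) (- qK p)"
  have conj: "?conj * p = (norm p)\<^sup>2 *\<^sub>R 1" "p * ?conj = (norm p)\<^sup>2 *\<^sub>R 1"
    unfolding norm_quat_squared
    by (simp_all add: times_quat_def one_quat_def quat_eq_iff power2_eq_square)
  show "inverse p * p = 1" "p * inverse p = 1" if "p \<noteq> 0"
    using that unfolding inverse_quat_def scale_left scale_right conj by simp_all
  have "(norm (p * q))\<^sup>2 = (norm p * norm q)\<^sup>2"
    unfolding norm_quat_squared power_mult_distrib
    by (simp add: times_quat_def) (simp add: power2_eq_square algebra_simps)
  then show "norm (p * q) = norm p * norm q" by simp
qed

end


section \<open>Slices\<close>

definition imag_units :: "quat set" where
  "imag_units = {J. J\<^sup>2 = -1}"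

definition slice_plane :: "quat \<Rightarrow> quat set" where
  "slice_plane I = {of_real x + y *\<^sub>R I | x y. True}"

definition half_plane :: "quat \<Rightarrow> quat set" where
  "half_plane I = {of_real x + y *\<^sub>R I | x y. y > 0}"

definition axially_symmetric :: "quat set \<Rightarrow> bool" where
  "axially_symmetric T \<longleftrightarrow>
    (\<forall>x y. \<forall>I\<in>imag_units. of_real x + y *\<^sub>R I \<in> T \<longrightarrow>
      (\<forall>J\<in>imag_units. of_real x + y *\<^sub>R J \<in> T))"

definition slice_domain :: "quat set \<Rightarrow> bool" where
  "slice_domain \<Omega> \<longleftrightarrow>
    \<Omega> \<noteq> {} \<and> open \<Omega> \<and> connected \<Omega> \<and> \<Omega> \<inter> \<real> \<noteq> {} \<and>
    (\<forall>I\<in>imag_units.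
      \<Omega> \<inter> slice_plane I \<noteq> {} \<and>
      openin (top_of_set (slice_plane I)) (\<Omega> \<inter> slice_plane I) \<and>
      connected (\<Omega> \<inter> slice_plane I))"


section \<open>Slice regular functions and extension triplets\<close>

text \<open>Functions on \<open>\<Omega>\<close> are total functions whose values outside \<open>\<Omega>\<close> are irrelevant.
  The restriction of \<open>f\<close> to the slice through \<open>I\<close> is seen as a function of the real coordinates
  \<open>(x, y)\<close>; its partial derivatives are \<open>fx\<close> and \<open>fy\<close>. The unrestricted filters \<open>at x\<close> and \<open>at y\<close>
  are the intended ones because \<open>\<Omega>\<close> is always open here.\<close>

definition slice_regular :: "(quat \<Rightarrow> quat) \<Rightarrow> quat set \<Rightarrow> bool" where
  "slice_regular f \<Omega> \<longleftrightarrow>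
    (\<forall>I\<in>imag_units. \<exists>fx fy :: real \<times> real \<Rightarrow> quat.
      continuous_on {(x, y). of_real x + y *\<^sub>R I \<in> \<Omega>} fx \<and>
      continuous_on {(x, y). of_real x + y *\<^sub>R I \<in> \<Omega>} fy \<and>
      (\<forall>x y. of_real x + y *\<^sub>R I \<in> \<Omega> \<longrightarrow>
        ((\<lambda>t. f (of_real t + y *\<^sub>R I)) has_vector_derivative fx (x, y)) (at x) \<and>
        ((\<lambda>t. f (of_real x + t *\<^sub>R I)) has_vector_derivative fy (x, y)) (at y) \<and>
        (1 / 2) *\<^sub>R (fx (x, y) + I * fy (x, y)) = 0))"

definition extension_triplet ::
  "(quat \<Rightarrow> quat) \<Rightarrow> quat set \<Rightarrow> (quat \<Rightarrow> quat) \<Rightarrow> quat set \<Rightarrow> quat set \<Rightarrow> bool" where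
  "extension_triplet f \<Omega> g N \<Lambda> \<longleftrightarrow>
    slice_domain N \<and> axially_symmetric N \<and> N \<inter> \<real> \<subseteq> \<Omega> \<and>
    slice_regular g N \<and>
    slice_domain \<Lambda> \<and> \<Lambda> \<subseteq> \<Omega> \<inter> N \<and> (\<forall>q\<in>\<Lambda>. f q = g q)"

end

theory Submission
  imports Defs "HOL-Complex_Analysis.Conformal_Mappings"
begin

text \<open>Write a quaternion as \<open>x + y I\<close> with \<open>y \<ge> 0\<close> and \<open>I\<close> an imaginary unit. A symmetric set is
  determined by the points \<open>x + i y\<close> of the closed complex half plane that it represents, so \<open>C\<close>
  becomes a planar continuum. It is enlarged, if it misses the real line, by a path in the slice of
  \<open>J0\<close> up to the first real point; this gives a planar continuum \<open>K\<close> with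
  \<open>K \<inter> \<real> = {a..b}\<close> whose copy on the half plane of \<open>J0\<close> lies in \<open>\<Omega>\<close>
  (\<open>planar_continuum\<close>).

  By compactness there are a union \<open>T\<close> of discs centred on \<open>{a..b}\<close> whose copies on all slices lie
  in \<open>\<Omega>\<close>, and a union \<open>V\<close> of discs in the open half plane, centred at the points of \<open>K - T\<close>, whose
  copies on the half planes of all units at distance less than \<open>\<eta>\<close> from \<open>J0\<close> lie in \<open>\<Omega>\<close>
  (\<open>planar_neighbourhoods\<close>). The set \<open>N\<close> consists of all copies of \<open>T\<close> and \<open>V\<close>, and \<open>\<Lambda>\<close> of the
  copies of \<open>T\<close> and of those copies of \<open>V\<close> whose unit is at distance less than \<open>\<eta>\<close> from \<open>J0\<close>.
  Each slice of \<open>\<Lambda>\<close> is connected, even when it contains no copy of \<open>V\<close>, because \<open>T\<close> is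
  connected; it is here that \<open>K \<inter> \<real>\<close> has to be an interval.

  The function \<open>g\<close> is given on \<open>N\<close> by the representation formula, from the values of \<open>f\<close> on the half
  planes of \<open>J0\<close> and of a second unit \<open>J1 \<noteq> J0\<close> with \<open>norm (J1 - J0) < \<eta>\<close>. Its coefficients
  intertwine the units (\<open>rep_coeff_intertwine\<close>), so the result is regular on the copies of \<open>V\<close>.
  On the copies of \<open>T\<close>, and on those of \<open>T \<union> V\<close> for units close to \<open>J0\<close>, both \<open>f\<close> and the formula are regular, and they agree
  on the real points; hence they agree by the identity principle (\<open>slice_identity_principle\<close>). This
  shows that \<open>g\<close> is regular across the real line and equal to \<open>f\<close> on \<open>\<Lambda>\<close>.

  Regularity is handled through the notion \<open>slice_differentiable\<close>, which is local and which becomes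
  complex differentiability after composition with suitable real linear maps to the complex
  numbers.\<close>

section \<open>Quaternions in slice coordinates\<close>

text \<open>The copy of \<open>z = x + i y\<close> in the slice of \<open>I\<close>, that is \<open>x + y I\<close>. For an imaginary unit \<open>I\<close>
  it is an isometric algebra embedding; it is used for arbitrary \<open>I\<close>.\<close>

definition slice_emb :: "quat \<Rightarrow> complex \<Rightarrow> quat" where
  "slice_emb I z = of_real (Re z) + Im z *\<^sub>R I"

text \<open>The imaginary part, as a quaternion with real part \<open>0\<close>.\<close>

definition quat_im :: "quat \<Rightarrow> quat" where
  "quat_im q = q - of_real (qRe q)"

text \<open>The point of the closed upper half plane that represents the sphere \<open>x + y\<S>\<close> of \<open>q\<close>.\<close>

definition sphere_coord :: "quat \<Rightarrow> complex" where
  "sphere_coord q = Complex (qRe q) (norm (quat_im q))"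

lemma of_real_quat: "of_real x = Quat x 0 0 0"
  by (simp add: of_real_def one_quat_def quat_eq_iff)

lemma imag_units_iff: "J \<in> imag_units \<longleftrightarrow> qRe J = 0 \<and> norm J = 1"
proof -
  have "norm J = 1 \<longleftrightarrow> (norm J)\<^sup>2 = 1"
    by (metis abs_norm_cancel power2_eq_1_iff abs_1 abs_minus_cancel power_one)
  moreover have "J\<^sup>2 = -1 \<longleftrightarrow> qRe J = 0 \<and> (norm J)\<^sup>2 = 1"
  proof
    assume "J\<^sup>2 = -1"
    then have *: "qRe J * qRe J - qI J * qI J - qJ J * qJ J - qK J * qK J = -1"
      "qRe J * qI J = 0" "qRe J * qJ J = 0" "qRe J * qK J = 0"
      by (simp_all add: power2_eq_square[of J] times_quat_def quat_eq_iff one_quat_def algebra_simps)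
    have "qRe J = 0"
    proof (rule ccontr)
      assume "qRe J \<noteq> 0"
      then have "qI J = 0" "qJ J = 0" "qK J = 0" using * by auto
      then show False using *(1) by (simp add: not_square_less_zero)
          (metis not_square_less_zero neg_less_0_iff_less zero_less_one)
    qed
    then show "qRe J = 0 \<and> (norm J)\<^sup>2 = 1"
      using *(1) unfolding norm_quat_squared by (simp add: power2_eq_square)
  next
    assume "qRe J = 0 \<and> (norm J)\<^sup>2 = 1"
    then have "qRe J = 0" "qI J * qI J + qJ J * qJ J + qK J * qK J = 1"
      unfolding norm_quat_squared by (auto simp: power2_eq_square)
    then show "J\<^sup>2 = -1"
      by (simp add: power2_eq_square times_quat_def quat_eq_iff one_quat_def)
  qed
  ultimately show ?thesis by (simp add: imag_units_def)
qed

lemma imag_units_uminus: "I \<in> imag_units \<Longrightarrow> - I \<in> imag_units"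
  by (simp add: imag_units_iff)

lemma imag_units_square: "I \<in> imag_units \<Longrightarrow> I * I = -1"
  by (simp add: imag_units_def power2_eq_square)

lemma slice_emb_uminus: "slice_emb (- I) z = slice_emb I (cnj z)"
  by (simp add: slice_emb_def)

lemma slice_emb_of_real: "slice_emb I (of_real x) = of_real x"
  by (simp add: slice_emb_def)

lemma bounded_linear_slice_emb: "bounded_linear (slice_emb I)"
  unfolding slice_emb_def of_real_def
  by (intro bounded_linear_add bounded_linear_scaleR_const[OF bounded_linear_Re]
      bounded_linear_scaleR_const[OF bounded_linear_Im])

lemma continuous_on_slice_emb [continuous_intros]:
  "continuous_on A g \<Longrightarrow> continuous_on A (\<lambda>x. slice_emb I (g x))"
  using bounded_linear.continuous_on[OF bounded_linear_slice_emb] .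

lemma slice_emb_Complex: "slice_emb I (Complex x y) = of_real x + y *\<^sub>R I"
  by (simp add: slice_emb_def)

lemma slice_plane_eq: "slice_plane I = range (slice_emb I)"
proof -
  have "slice_emb I z \<in> slice_plane I" for z
    unfolding slice_plane_def slice_emb_def by blast
  moreover have "q \<in> range (slice_emb I)" if "q \<in> slice_plane I" for q
    using that unfolding slice_plane_def by (force simp flip: slice_emb_Complex)
  ultimately show ?thesis by blast
qed

lemma half_plane_eq: "half_plane I = slice_emb I ` {z. Im z > 0}"
proof -
  have "slice_emb I z \<in> half_plane I" if "Im z > 0" for z
    using that unfolding half_plane_def slice_emb_def by blast
  moreover have "q \<in> slice_emb I ` {z. Im z > 0}" if "q \<in> half_plane I" for q
    using that unfolding half_plane_def by (force simp flip: slice_emb_Complex)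
  ultimately show ?thesis by blast
qed

lemma quat_im_slice_emb: "I \<in> imag_units \<Longrightarrow> quat_im (slice_emb I z) = Im z *\<^sub>R I"
  by (simp add: quat_im_def slice_emb_def imag_units_iff of_real_quat quat_eq_iff)

lemma norm_slice_emb: "I \<in> imag_units \<Longrightarrow> norm (slice_emb I z) = norm z"
proof -
  assume "I \<in> imag_units"
  then have I: "qRe I = 0" "(norm I)\<^sup>2 = 1" by (simp_all add: imag_units_iff)
  have "(norm (slice_emb I z))\<^sup>2 = (Re z)\<^sup>2 + (Im z)\<^sup>2 * ((qI I)\<^sup>2 + (qJ I)\<^sup>2 + (qK I)\<^sup>2)"
    unfolding norm_quat_squared using I(1)
    by (simp add: slice_emb_def of_real_quat power_mult_distrib distrib_left)
  also have "\<dots> = (norm z)\<^sup>2"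
    using I norm_quat_squared[of I] by (simp add: cmod_power2)
  finally show ?thesis by simp
qed

lemma dist_slice_emb:
  "I \<in> imag_units \<Longrightarrow> dist (slice_emb I z) (slice_emb I w) = dist z w"
  by (metis bounded_linear.linear bounded_linear_slice_emb dist_norm linear_diff norm_slice_emb)

lemma slice_emb_eq_iff: "I \<in> imag_units \<Longrightarrow> slice_emb I z = slice_emb I w \<longleftrightarrow> z = w"
  by (metis dist_slice_emb dist_eq_0_iff)

lemma sphere_coord_slice_emb:
  assumes "I \<in> imag_units"
  shows "sphere_coord (slice_emb I z) = Complex (Re z) \<bar>Im z\<bar>"
  using assms unfolding sphere_coord_def quat_im_slice_emb[OF assms]
  by (simp add: imag_units_iff slice_emb_def of_real_quat)

lemma continuous_on_qRe [continuous_intros]: "continuous_on A qRe"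
proof -
  have "qRe = (\<lambda>q. inner q 1)"
    by (simp add: inner_quat_def one_quat_def fun_eq_iff)
  moreover have "continuous_on A (\<lambda>q. inner q (1 :: quat))"
    by (intro continuous_intros)
  ultimately show ?thesis by metis
qed

lemma continuous_on_quat_im [continuous_intros]: "continuous_on A quat_im"
  unfolding quat_im_def by (intro continuous_intros)

lemma continuous_on_sphere_coord [continuous_intros]: "continuous_on A sphere_coord"
  unfolding sphere_coord_def Complex_eq by (intro continuous_intros)

text \<open>Every quaternion lies on a slice, with nonnegative imaginary coordinate. The unit \<open>J\<close> only
  serves as a witness for real \<open>q\<close>, which lie on all slices.\<close>

lemma quat_in_slice:
  assumes "J \<in> imag_units"
  obtains I where "I \<in> imag_units" "q = slice_emb I (sphere_coord q)"
proof (cases "quat_im q = 0")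
  case True
  then have "q = slice_emb J (sphere_coord q)"
    by (simp add: quat_im_def slice_emb_def sphere_coord_def)
  then show ?thesis using that assms by blast
next
  case False
  have "qRe (quat_im q) = 0" by (simp add: quat_im_def of_real_quat)
  then have "sgn (quat_im q) \<in> imag_units"
    using False by (simp add: imag_units_iff sgn_div_norm)
  moreover have "q = slice_emb (sgn (quat_im q)) (sphere_coord q)"
    using False by (simp add: slice_emb_def sphere_coord_def sgn_div_norm) (simp add: quat_im_def)
  ultimately show ?thesis using that by blast
qed

lemma Reals_slice_emb:
  assumes "I \<in> imag_units"
  shows "slice_emb I z \<in> \<real> \<longleftrightarrow> Im z = 0"
proof
  assume "slice_emb I z \<in> \<real>"
  then obtain x where "slice_emb I z = slice_emb I (of_real x)"
    by (auto simp: slice_emb_of_real elim: Reals_cases)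
  then show "Im z = 0" using slice_emb_eq_iff[OF assms] by simp
qed (simp add: slice_emb_def)

section \<open>Slice differentiability and the identity principle\<close>

text \<open>\<open>h\<close>, seen as a function of the coordinate of the slice of \<open>I\<close>, is differentiable at \<open>z\<close>, and its
  differential is linear over \<open>\<real> + I\<real>\<close> acting by multiplication on the left.\<close>

definition slice_differentiable :: "quat \<Rightarrow> (complex \<Rightarrow> quat) \<Rightarrow> complex \<Rightarrow> bool" where
  "slice_differentiable I h z \<longleftrightarrow> (\<exists>c. (h has_derivative (\<lambda>d. slice_emb I d * c)) (at z))"

lemma slice_differentiable_transform:
  assumes "slice_differentiable I h z" "open S" "z \<in> S" "\<And>w. w \<in> S \<Longrightarrow> h w = k w"
  shows "slice_differentiable I k z"
  using assms has_derivative_transform_within_open unfolding slice_differentiable_def by blast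

lemma slice_differentiable_cnj:
  assumes "slice_differentiable (- I) h (cnj z)"
  shows "slice_differentiable I (\<lambda>w. h (cnj w)) z"
proof -
  from assms obtain c where "(h has_derivative (\<lambda>d. slice_emb (- I) d * c)) (at (cnj z))"
    unfolding slice_differentiable_def by blast
  moreover have "(cnj has_derivative cnj) (at z)"
    by (rule bounded_linear_imp_has_derivative[OF bounded_linear_cnj])
  ultimately have "((\<lambda>w. h (cnj w)) has_derivative (\<lambda>d. slice_emb (- I) (cnj d) * c)) (at z)"
    by (rule has_derivative_compose[rotated])
  then show ?thesis
    unfolding slice_differentiable_def by (auto simp: slice_emb_uminus)
qed

text \<open>Left multiplication by an element that intertwines \<open>J\<close> and \<open>I\<close> carries functions that are
  differentiable along the slice of \<open>J\<close> to functions that are so along the slice of \<open>I\<close>.\<close>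

lemma slice_differentiable_intertwine:
  assumes "slice_differentiable J h z" "p * J = I * p"
  shows "slice_differentiable I (\<lambda>w. p * h w) z"
proof -
  from assms obtain c where "(h has_derivative (\<lambda>d. slice_emb J d * c)) (at z)"
    unfolding slice_differentiable_def by blast
  then have "((\<lambda>w. p * h w) has_derivative (\<lambda>d. p * (slice_emb J d * c))) (at z)"
    by (rule has_derivative_mult_right)
  moreover have "p * (slice_emb J d * c) = slice_emb I d * (p * c)" for d
  proof -
    have "p * slice_emb J d = slice_emb I d * p"
      using assms(2) by (simp add: slice_emb_def distrib_left distrib_right of_real_def)
    then show ?thesis by (metis mult.assoc)
  qed
  ultimately show ?thesis unfolding slice_differentiable_def by auto
qed

lemma slice_differentiable_add:
  assumes "slice_differentiable I h z" "slice_differentiable I k z"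
  shows "slice_differentiable I (\<lambda>w. h w + k w) z"
proof -
  from assms obtain c d where
    "(h has_derivative (\<lambda>d. slice_emb I d * c)) (at z)"
    "(k has_derivative (\<lambda>x. slice_emb I x * d)) (at z)"
    unfolding slice_differentiable_def by blast
  then have "((\<lambda>w. h w + k w) has_derivative (\<lambda>x. slice_emb I x * (c + d))) (at z)"
    by (auto intro!: derivative_eq_intros simp: algebra_simps)
  then show ?thesis unfolding slice_differentiable_def by blast
qed

text \<open>For an imaginary unit \<open>I\<close> this is complex linear in \<open>q\<close> when \<open>\<i>\<close> acts on quaternions by left
  multiplication with \<open>I\<close>, so it turns slice differentiable functions into holomorphic ones.\<close>

definition slice_functional :: "quat \<Rightarrow> quat \<Rightarrow> quat \<Rightarrow> complex" where
  "slice_functional I w q = Complex (inner q w) (- inner (I * q) w)"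

lemma bounded_linear_slice_functional: "bounded_linear (slice_functional I w)"
  unfolding linear_conv_bounded_linear[symmetric]
  by (rule linearI) (simp_all add: slice_functional_def complex_eq_iff inner_add_left algebra_simps)

lemma slice_functional_slice_emb:
  assumes "I \<in> imag_units"
  shows "slice_functional I w (slice_emb I z * q) = z * slice_functional I w q"
proof -
  have "I * (I * q) = - q"
    using imag_units_square[OF assms] by (metis mult.assoc mult_minus1)
  then show ?thesis
    by (simp add: slice_functional_def slice_emb_def complex_eq_iff algebra_simps of_real_def)
qed

lemma has_field_derivative_slice_functional:
  assumes "I \<in> imag_units" "(h has_derivative (\<lambda>d. slice_emb I d * c)) (at z)"
  shows "((\<lambda>z. slice_functional I w (h z)) has_field_derivative slice_functional I w c) (at z)"
proof -
  have "((\<lambda>z. slice_functional I w (h z)) has_derivative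
      (\<lambda>d. slice_functional I w (slice_emb I d * c))) (at z)"
    by (rule bounded_linear.has_derivative[OF bounded_linear_slice_functional assms(2)])
  then show ?thesis
    by (simp add: has_field_derivative_def slice_functional_slice_emb[OF assms(1)] mult_commute_abs)
qed

lemma holomorphic_on_slice_functional:
  assumes "I \<in> imag_units" "\<And>z. z \<in> S \<Longrightarrow> slice_differentiable I h z"
  shows "(\<lambda>z. slice_functional I w (h z)) holomorphic_on S"
  unfolding holomorphic_on_def field_differentiable_def
proof
  fix z assume "z \<in> S"
  then obtain c where "(h has_derivative (\<lambda>d. slice_emb I d * c)) (at z)"
    using assms(2) unfolding slice_differentiable_def by blast
  then show "\<exists>f'. ((\<lambda>z. slice_functional I w (h z)) has_field_derivative f') (at z within S)"
    using has_field_derivative_slice_functional[OF assms(1)] has_field_derivative_at_within by blast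
qed

lemma slice_identity_principle:
  assumes I: "I \<in> imag_units" and S: "open S" "connected S"
    and h: "\<And>z. z \<in> S \<Longrightarrow> slice_differentiable I h z"
    and k: "\<And>z. z \<in> S \<Longrightarrow> slice_differentiable I k z"
    and U: "U \<subseteq> S" "\<xi> \<in> S" "\<xi> islimpt U" "\<And>z. z \<in> U \<Longrightarrow> h z = k z"
    and z: "z \<in> S"
  shows "h z = k z"
proof -
  have "slice_functional I w (h z) - slice_functional I w (k z) = 0" for w
  proof (rule analytic_continuation[OF _ S U(1-3) _ z])
    show "(\<lambda>z. slice_functional I w (h z) - slice_functional I w (k z)) holomorphic_on S"
      by (intro holomorphic_on_diff holomorphic_on_slice_functional I h k)
  qed (simp add: U(4))
  then have "inner (h z) w = inner (k z) w" for w
    by (simp add: slice_functional_def complex_eq_iff)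
  then show ?thesis
    by (blast intro: euclidean_eqI)
qed

text \<open>Slice regularity is slice differentiability at each point of each slice. In one direction
  continuous partial derivatives give a differential; in the other direction the partial
  derivatives are continuous since those of holomorphic functions are. This characterisation is
  local.\<close>

lemma slice_differentiable_if_partials:
  fixes fx fy :: "real \<times> real \<Rightarrow> quat"
  assumes I: "I \<in> imag_units" and S: "open S" "z \<in> S"
    and cont: "continuous_on {(x, y). Complex x y \<in> S} fy"
    and fx: "((\<lambda>t. h (Complex t (Im z))) has_vector_derivative fx (Re z, Im z)) (at (Re z))"
    and fy: "\<And>x y. Complex x y \<in> S \<Longrightarrow>
      ((\<lambda>t. h (Complex x t)) has_vector_derivative fy (x, y)) (at y)"
    and CR: "fx (Re z, Im z) + I * fy (Re z, Im z) = 0"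
  shows "slice_differentiable I h z"
proof -
  define S' where "S' = {(x, y). Complex x y \<in> S}"
  have "S' = (\<lambda>p. Complex (fst p) (snd p)) -` S" by (auto simp: S'_def)
  moreover have cC: "continuous_on UNIV (\<lambda>p::real \<times> real. Complex (fst p) (snd p))"
    unfolding Complex_eq by (intro continuous_intros)
  ultimately have "open S'" using S(1) by (simp add: open_vimage)
  moreover have "(Re z, Im z) \<in> S'" using S by (simp add: S'_def)
  ultimately obtain X Y where XY: "open X" "open Y" "(Re z, Im z) \<in> X \<times> Y" "X \<times> Y \<subseteq> S'"
    by (metis open_prod_elim)
  then obtain e where e: "e > 0" "ball (Im z) e \<subseteq> Y"
    by (metis mem_Sigma_iff open_contains_ball)
  define B where "B = ball (Im z) e"
  have "((\<lambda>(x, y). h (Complex x y)) has_derivative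
     (\<lambda>(tx, ty). tx *\<^sub>R fx (Re z, Im z) + blinfun_scaleR_left (fy (Re z, Im z)) ty))
     (at (Re z, Im z) within X \<times> B)"
  proof (rule has_derivative_partialsI[where fy = "\<lambda>x y. blinfun_scaleR_left (fy (x, y))"])
    show "((\<lambda>x. h (Complex x (Im z))) has_derivative (\<lambda>tx. tx *\<^sub>R fx (Re z, Im z)))
       (at (Re z) within X)"
      using fx has_derivative_at_withinI has_vector_derivative_def by blast
    show "((\<lambda>y. h (Complex x y)) has_derivative blinfun_scaleR_left (fy (x, y))) (at y within B)"
      if "x \<in> X" "y \<in> B" for x y
    proof -
      have "Complex x y \<in> S" using that XY e unfolding B_def S'_def by blast
      from fy[OF this] show ?thesis
        by (simp add: has_vector_derivative_def has_derivative_at_withinI)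
    qed
    have "continuous_on S' fy" using cont by (simp add: S'_def)
    then have "continuous (at (Re z, Im z)) fy"
      using \<open>open S'\<close> \<open>(Re z, Im z) \<in> S'\<close> by (simp add: continuous_on_eq_continuous_at)
    then have "continuous (at (Re z, Im z)) (\<lambda>p. blinfun_scaleR_left (fy p))"
      by (rule bounded_linear.continuous[OF bounded_linear_blinfun_scaleR_left])
    then show "continuous (at (Re z, Im z) within X \<times> B)
       (\<lambda>(x, y). blinfun_scaleR_left (fy (x, y)))"
      by (simp add: continuous_at_imp_continuous_at_within case_prod_beta')
  qed (use e in \<open>auto simp: B_def\<close>)
  moreover have "at (Re z, Im z) within X \<times> B = at (Re z, Im z)"
    using XY e by (intro at_within_open) (auto simp: B_def open_Times)
  ultimately have D: "((\<lambda>(x, y). h (Complex x y)) has_derivative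
     (\<lambda>(tx, ty). tx *\<^sub>R fx (Re z, Im z) + ty *\<^sub>R fy (Re z, Im z))) (at (Re z, Im z))"
    by simp
  have "((\<lambda>w. (Re w, Im w)) has_derivative (\<lambda>w. (Re w, Im w))) (at z)"
    by (intro bounded_linear_imp_has_derivative bounded_linear_Pair bounded_linear_Re
        bounded_linear_Im)
  from has_derivative_compose[OF this D]
  have "(h has_derivative (\<lambda>d. Re d *\<^sub>R fx (Re z, Im z) + Im d *\<^sub>R fy (Re z, Im z))) (at z)"
    by simp
  moreover have "fy (Re z, Im z) = I * fx (Re z, Im z)"
  proof -
    have "I * (fx (Re z, Im z) + I * fy (Re z, Im z)) = 0" using CR by simp
    moreover have "I * (I * fy (Re z, Im z)) = - fy (Re z, Im z)"
      using imag_units_square[OF I] by (metis mult.assoc mult_minus1)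
    ultimately show ?thesis by (simp add: algebra_simps)
  qed
  ultimately have "(h has_derivative (\<lambda>d. slice_emb I d * fx (Re z, Im z))) (at z)"
    by (simp add: slice_emb_def algebra_simps of_real_def)
  then show ?thesis unfolding slice_differentiable_def by blast
qed

lemma slice_regular_iff:
  assumes "open \<Omega>"
  shows "slice_regular f \<Omega> \<longleftrightarrow>
    (\<forall>I\<in>imag_units. \<forall>z. slice_emb I z \<in> \<Omega> \<longrightarrow> slice_differentiable I (\<lambda>w. f (slice_emb I w)) z)"
proof
  assume R: "slice_regular f \<Omega>"
  show "\<forall>I\<in>imag_units. \<forall>z. slice_emb I z \<in> \<Omega> \<longrightarrow> slice_differentiable I (\<lambda>w. f (slice_emb I w)) z"
  proof (intro ballI allI impI)
    fix I z assume I: "I \<in> imag_units" and z: "slice_emb I z \<in> \<Omega>"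
    from R I obtain fx fy :: "real \<times> real \<Rightarrow> quat" where
      c: "continuous_on {(x, y). of_real x + y *\<^sub>R I \<in> \<Omega>} fy" and
      D: "\<And>x y. of_real x + y *\<^sub>R I \<in> \<Omega> \<Longrightarrow>
        ((\<lambda>t. f (of_real t + y *\<^sub>R I)) has_vector_derivative fx (x, y)) (at x) \<and>
        ((\<lambda>t. f (of_real x + t *\<^sub>R I)) has_vector_derivative fy (x, y)) (at y) \<and>
        (1 / 2) *\<^sub>R (fx (x, y) + I * fy (x, y)) = 0"
      unfolding slice_regular_def by blast
    have "open (slice_emb I -` \<Omega>)"
      using assms by (intro open_vimage) (auto intro: continuous_intros)
    then show "slice_differentiable I (\<lambda>w. f (slice_emb I w)) z"
      by (rule slice_differentiable_if_partials[OF I, of _ z fy _ fx])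
        (use c D z in \<open>auto simp: slice_emb_def\<close>)
  qed
next
  assume R: "\<forall>I\<in>imag_units. \<forall>z. slice_emb I z \<in> \<Omega> \<longrightarrow>
    slice_differentiable I (\<lambda>w. f (slice_emb I w)) z"
  show "slice_regular f \<Omega>"
    unfolding slice_regular_def
  proof
    fix I assume I: "I \<in> imag_units"
    define S where "S = slice_emb I -` \<Omega>"
    define h where "h = (\<lambda>w. f (slice_emb I w))"
    have "open S"
      unfolding S_def using assms by (intro open_vimage) (auto intro: continuous_intros)
    have "\<forall>z\<in>S. \<exists>c. (h has_derivative (\<lambda>d. slice_emb I d * c)) (at z)"
      using R I by (auto simp: S_def h_def slice_differentiable_def)
    then obtain c where c: "\<And>z. z \<in> S \<Longrightarrow> (h has_derivative (\<lambda>d. slice_emb I d * c z)) (at z)"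
      by metis
    have "continuous_on S c"
    proof (rule continuous_on_componentwise[THEN iffD2], rule ballI)
      fix w :: quat
      let ?F = "\<lambda>z. slice_functional I w (h z)"
      have F: "(?F has_field_derivative slice_functional I w (c z)) (at z)" if "z \<in> S" for z
        using has_field_derivative_slice_functional[OF I c[OF that]] .
      then have "?F holomorphic_on S"
        by (auto simp: holomorphic_on_def field_differentiable_def intro: has_field_derivative_at_within)
      then have "continuous_on S (\<lambda>z. Re (deriv ?F z))"
        by (intro continuous_intros holomorphic_on_imp_continuous_on holomorphic_deriv \<open>open S\<close>)
      moreover have "Re (deriv ?F z) = inner (c z) w" if "z \<in> S" for z
        using DERIV_imp_deriv[OF F[OF that]] by (simp add: slice_functional_def)
      ultimately show "continuous_on S (\<lambda>z. inner (c z) w)"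
        by simp
    qed
    moreover have "continuous_on A (\<lambda>p::real \<times> real. Complex (fst p) (snd p))" for A
      unfolding Complex_eq by (intro continuous_intros)
    ultimately have cc: "continuous_on {(x, y). of_real x + y *\<^sub>R I \<in> \<Omega>} (\<lambda>(x, y). c (Complex x y))"
      unfolding case_prod_beta'
      by (rule continuous_on_compose2) (auto simp: S_def slice_emb_def)
    have D: "((\<lambda>t. f (of_real t + y *\<^sub>R I)) has_vector_derivative c (Complex x y)) (at x) \<and>
        ((\<lambda>t. f (of_real x + t *\<^sub>R I)) has_vector_derivative I * c (Complex x y)) (at y) \<and>
        (1 / 2) *\<^sub>R (c (Complex x y) + I * (I * c (Complex x y))) = 0"
      if "of_real x + y *\<^sub>R I \<in> \<Omega>" for x y
    proof -
      have "Complex x y \<in> S" using that by (simp add: S_def slice_emb_def)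
      note h = c[OF this]
      have "((\<lambda>t. Complex t y) has_derivative (\<lambda>t. of_real t)) (at x)"
        unfolding Complex_eq by (auto intro!: derivative_eq_intros)
      from has_derivative_compose[OF this h]
      have 1: "((\<lambda>t. f (of_real t + y *\<^sub>R I)) has_vector_derivative c (Complex x y)) (at x)"
        by (simp add: h_def slice_emb_def has_vector_derivative_def of_real_def)
      have "((\<lambda>t. Complex x t) has_derivative (\<lambda>t. \<i> * of_real t)) (at y)"
        unfolding Complex_eq by (auto intro!: derivative_eq_intros)
      from has_derivative_compose[OF this h]
      have 2: "((\<lambda>t. f (of_real x + t *\<^sub>R I)) has_vector_derivative I * c (Complex x y)) (at y)"
        by (simp add: h_def slice_emb_def has_vector_derivative_def)
      have "I * (I * c (Complex x y)) = - c (Complex x y)"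
        using imag_units_square[OF I] by (metis mult.assoc mult_minus1)
      with 1 2 show ?thesis by simp
    qed
    show "\<exists>fx fy :: real \<times> real \<Rightarrow> quat.
      continuous_on {(x, y). of_real x + y *\<^sub>R I \<in> \<Omega>} fx \<and>
      continuous_on {(x, y). of_real x + y *\<^sub>R I \<in> \<Omega>} fy \<and>
      (\<forall>x y. of_real x + y *\<^sub>R I \<in> \<Omega> \<longrightarrow>
        ((\<lambda>t. f (of_real t + y *\<^sub>R I)) has_vector_derivative fx (x, y)) (at x) \<and>
        ((\<lambda>t. f (of_real x + t *\<^sub>R I)) has_vector_derivative fy (x, y)) (at y) \<and>
        (1 / 2) *\<^sub>R (fx (x, y) + I * fy (x, y)) = 0)"
    proof (rule exI[of _ "\<lambda>(x, y). c (Complex x y)"],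
        rule exI[of _ "\<lambda>(x, y). I * c (Complex x y)"], intro conjI)
      show "continuous_on {(x, y). of_real x + y *\<^sub>R I \<in> \<Omega>} (\<lambda>(x, y). I * c (Complex x y))"
        using continuous_on_mult_left[OF cc, of I] by (simp add: case_prod_beta')
      show "continuous_on {(x, y). of_real x + y *\<^sub>R I \<in> \<Omega>} (\<lambda>(x, y). c (Complex x y))"
        by (rule cc)
      show "\<forall>x y. of_real x + y *\<^sub>R I \<in> \<Omega> \<longrightarrow>
        ((\<lambda>t. f (of_real t + y *\<^sub>R I)) has_vector_derivative
          (case (x, y) of (x, y) \<Rightarrow> c (Complex x y))) (at x) \<and>
        ((\<lambda>t. f (of_real x + t *\<^sub>R I)) has_vector_derivative
          (case (x, y) of (x, y) \<Rightarrow> I * c (Complex x y))) (at y) \<and>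
        (1 / 2) *\<^sub>R ((case (x, y) of (x, y) \<Rightarrow> c (Complex x y))
          + I * (case (x, y) of (x, y) \<Rightarrow> I * c (Complex x y))) = 0"
        unfolding prod.case using D by blast
    qed
  qed
qed

section \<open>The representation formula\<close>

text \<open>For units \<open>J \<noteq> K\<close>, the value at \<open>x + y I\<close> of a function regular near the real line is a
  combination, with coefficients \<open>rep_coeff J K I\<close> and \<open>rep_coeff K J I\<close> on the left, of its values
  at \<open>x + y J\<close> and \<open>x + y K\<close>.\<close>

definition rep_coeff :: "quat \<Rightarrow> quat \<Rightarrow> quat \<Rightarrow> quat" where
  "rep_coeff J K I = inverse (J - K) * J + I * inverse (J - K)"

lemma rep_coeff_sum:
  assumes "J \<noteq> K"
  shows "rep_coeff J K I + rep_coeff K J I = 1"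
proof -
  have "inverse (K - J) = - inverse (J - K)"
    using assms by (metis inverse_minus_eq minus_diff_eq)
  then have "rep_coeff J K I + rep_coeff K J I = inverse (J - K) * (J - K)"
    by (simp add: rep_coeff_def algebra_simps)
  then show ?thesis using assms by simp
qed

lemma rep_coeff_intertwine:
  assumes "I \<in> imag_units" "J \<in> imag_units"
  shows "rep_coeff J K I * J = I * rep_coeff J K I"
proof -
  have "x * J * J = - x" "I * (I * x) = - x" for x
    using imag_units_square[OF assms(1)] imag_units_square[OF assms(2)]
    by (metis mult.assoc mult_minus1 mult_minus1_right)+
  then show ?thesis
    by (simp add: rep_coeff_def distrib_left distrib_right mult.assoc)
qed

lemma slice_differentiable_rep:
  assumes "I \<in> imag_units" "J \<in> imag_units" "K \<in> imag_units"
    and "slice_differentiable J (\<lambda>w. f (slice_emb J w)) z"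
    and "slice_differentiable K (\<lambda>w. f (slice_emb K w)) z"
  shows "slice_differentiable I
    (\<lambda>w. rep_coeff J K I * f (slice_emb J w) + rep_coeff K J I * f (slice_emb K w)) z"
  using assms
  by (intro slice_differentiable_add) (auto intro!: slice_differentiable_intertwine rep_coeff_intertwine)

text \<open>Both sides are slice differentiable along \<open>I\<close>, and they agree at the real points of \<open>S\<close> because
  the coefficients add up to \<open>1\<close>. The set \<open>S\<close> need not be symmetric under conjugation: it may reach
  far into the upper half plane as long as it contains a real point.\<close>

lemma representation_formula:
  assumes units: "I \<in> imag_units" "J \<in> imag_units" "K \<in> imag_units" and "J \<noteq> K"
    and S: "open S" "connected S" "complex_of_real a \<in> S"
    and f: "\<And>L z. L \<in> {I, J, K} \<Longrightarrow> z \<in> S \<Longrightarrow> slice_differentiable L (\<lambda>w. f (slice_emb L w)) z"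
    and z: "z \<in> S"
  shows "f (slice_emb I z) = rep_coeff J K I * f (slice_emb J z) + rep_coeff K J I * f (slice_emb K z)"
proof (rule slice_identity_principle[OF units(1) S(1,2), where U = "S \<inter> range of_real" and \<xi> = "of_real a"])
  show "complex_of_real a islimpt S \<inter> range of_real"
    unfolding islimpt_approachable
  proof (intro allI impI)
    fix e :: real assume "e > 0"
    obtain d where d: "d > 0" "ball (complex_of_real a) d \<subseteq> S"
      using S openE by blast
    define m where "m = min d e / 2"
    have m: "0 < m" "m < d" "m < e" using d \<open>e > 0\<close> by (auto simp: m_def min_def)
    have dist: "dist (complex_of_real (a + m)) (of_real a) = m"
      using m unfolding dist_of_real by (simp add: dist_real_def)
    then have "complex_of_real (a + m) \<in> S"
      using m d(2) by (simp add: dist_commute subset_iff)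
    moreover have "complex_of_real (a + m) \<noteq> of_real a" using m by simp
    ultimately show "\<exists>x'\<in>S \<inter> range of_real. x' \<noteq> complex_of_real a \<and> dist x' (of_real a) < e"
      using dist m(3) by (intro bexI[of _ "complex_of_real (a + m)"] conjI IntI rangeI) simp_all
  qed
next
  fix w assume "w \<in> S \<inter> range complex_of_real"
  then show "f (slice_emb I w) = rep_coeff J K I * f (slice_emb J w) + rep_coeff K J I * f (slice_emb K w)"
    by (auto simp: slice_emb_of_real rep_coeff_sum[OF \<open>J \<noteq> K\<close>] simp flip: distrib_right)
qed (use assms in \<open>auto intro!: slice_differentiable_rep\<close>)

text \<open>The function given on all slices by the representation formula from the values of \<open>f\<close> on the
  upper half planes of \<open>J\<close> and \<open>K\<close>. At real points \<open>sgn (quat_im q)\<close> is \<open>0\<close> instead of a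
  unit, and the coefficients still add up to \<open>1\<close>.\<close>

definition regular_ext :: "(quat \<Rightarrow> quat) \<Rightarrow> quat \<Rightarrow> quat \<Rightarrow> quat \<Rightarrow> quat" where
  "regular_ext f J K q =
    rep_coeff J K (sgn (quat_im q)) * f (slice_emb J (sphere_coord q)) +
    rep_coeff K J (sgn (quat_im q)) * f (slice_emb K (sphere_coord q))"

lemma regular_ext_upper:
  assumes "I \<in> imag_units" "Im z > 0"
  shows "regular_ext f J K (slice_emb I z) =
    rep_coeff J K I * f (slice_emb J z) + rep_coeff K J I * f (slice_emb K z)"
proof -
  have "sgn (quat_im (slice_emb I z)) = I" "sphere_coord (slice_emb I z) = z"
    using assms by (simp_all add: quat_im_slice_emb sphere_coord_slice_emb sgn_scaleR sgn_div_norm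
        imag_units_iff)
  then show ?thesis by (simp add: regular_ext_def)
qed

lemma regular_ext_real:
  assumes "J \<noteq> K"
  shows "regular_ext f J K (of_real x) = f (of_real x)"
proof -
  have "quat_im (of_real x) = 0" "sphere_coord (of_real x) = of_real x"
    by (simp_all add: quat_im_def sphere_coord_def of_real_quat complex_eq_iff)
  then show ?thesis
    by (simp add: regular_ext_def slice_emb_of_real rep_coeff_sum[OF assms] flip: distrib_right)
qed

lemma regular_ext_eq:
  assumes units: "I \<in> imag_units" "J \<in> imag_units" "K \<in> imag_units" and "J \<noteq> K"
    and S: "open S" "connected S" "complex_of_real a \<in> S"
    and f: "\<And>L z. L \<in> {I, J, K} \<Longrightarrow> z \<in> S \<Longrightarrow> slice_differentiable L (\<lambda>w. f (slice_emb L w)) z"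
    and z: "z \<in> S" "Im z \<ge> 0"
  shows "regular_ext f J K (slice_emb I z) = f (slice_emb I z)"
proof (cases "Im z = 0")
  case True
  then have "slice_emb I z = of_real (Re z)" by (simp add: slice_emb_def)
  then show ?thesis by (simp add: regular_ext_real[OF \<open>J \<noteq> K\<close>])
next
  case False
  then show ?thesis
    using representation_formula[OF assms(1-9)] regular_ext_upper[OF units(1)] z by simp
qed

text \<open>Imaginary units are not isolated: \<open>J\<close> is moved in a direction \<open>u\<close> not parallel to it, and the
  result is normalised.\<close>

lemma exists_close_imag_unit:
  assumes J: "J \<in> imag_units" and "e > 0"
  obtains K where "K \<in> imag_units" "K \<noteq> J" "norm (K - J) < e"
proof -
  have "J \<noteq> 0" "qRe J = 0" "norm J = 1" using J by (auto simp: imag_units_iff)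
  obtain u where u: "qRe u = 0" "\<And>n. u \<noteq> n *\<^sub>R J"
  proof (cases "qJ J = 0 \<and> qK J = 0")
    case True
    show ?thesis
      by (rule that[of "Quat 0 0 1 0"]) (use True in \<open>auto simp: quat_eq_iff\<close>)
  next
    case False
    show ?thesis
      by (rule that[of "Quat 0 1 0 0"]) (use False in \<open>auto simp: quat_eq_iff\<close>)
  qed
  have "((\<lambda>t. sgn (J + t *\<^sub>R u)) \<longlongrightarrow> sgn (J + 0 *\<^sub>R u)) (at_right 0)"
    using \<open>J \<noteq> 0\<close> by (intro tendsto_intros) auto
  moreover have "sgn (J + 0 *\<^sub>R u) = J"
    using \<open>norm J = 1\<close> by (simp add: sgn_div_norm)
  ultimately have "((\<lambda>t. sgn (J + t *\<^sub>R u)) \<longlongrightarrow> J) (at_right 0)" by (simp only:)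
  from tendstoD[OF this \<open>e > 0\<close>] have "\<forall>\<^sub>F t in at_right 0. dist (sgn (J + t *\<^sub>R u)) J < e" .
  moreover have "\<forall>\<^sub>F t::real in at_right 0. t > 0"
    by (simp add: eventually_at_right_less)
  ultimately have "\<forall>\<^sub>F t in at_right 0. t > 0 \<and> dist (sgn (J + t *\<^sub>R u)) J < e"
    by eventually_elim auto
  then obtain t where t: "t > 0" "dist (sgn (J + t *\<^sub>R u)) J < e"
    using eventually_happens'[OF trivial_limit_at_right_real] by blast
  have *: "J + t *\<^sub>R u \<noteq> n *\<^sub>R J" for n
  proof
    assume "J + t *\<^sub>R u = n *\<^sub>R J"
    then have "t *\<^sub>R u = (n - 1) *\<^sub>R J" by (simp add: algebra_simps)
    then have "u = ((n - 1) / t) *\<^sub>R J"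
      using t(1) by (metis divideR_right divide_inverse_commute less_irrefl scaleR_scaleR)
    then show False using u by blast
  qed
  show ?thesis
  proof
    show "sgn (J + t *\<^sub>R u) \<in> imag_units"
      using *[of 0] u \<open>qRe J = 0\<close> by (simp add: imag_units_iff norm_sgn sgn_div_norm)
    show "sgn (J + t *\<^sub>R u) \<noteq> J"
    proof
      assume "sgn (J + t *\<^sub>R u) = J"
      then have "J + t *\<^sub>R u = norm (J + t *\<^sub>R u) *\<^sub>R J"
        using *[of 0] by (metis divideR_right norm_eq_zero scaleR_zero_left sgn_div_norm)
      then show False using * by blast
    qed
    show "norm (sgn (J + t *\<^sub>R u) - J) < e" using t by (simp add: dist_norm)
  qed
qed

section \<open>Slice domains built from planar sets\<close>

lemma slice_domainI:
  assumes "open \<Omega>" "of_real a \<in> \<Omega>"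
    and conn: "\<And>I. I \<in> imag_units \<Longrightarrow> connected (slice_emb I -` \<Omega>)"
  shows "slice_domain \<Omega>"
proof -
  define P where "P = (\<lambda>I. slice_emb I ` (slice_emb I -` \<Omega>))"
  have P: "\<Omega> \<inter> slice_plane I = P I" for I
    by (auto simp: P_def slice_plane_eq)
  have a: "of_real a \<in> P I" for I
    using assms(2) unfolding P_def by (metis image_eqI slice_emb_of_real vimageI)
  have c: "connected (P I)" if "I \<in> imag_units" for I
    unfolding P_def by (intro connected_continuous_image conn that continuous_intros)
  have "Quat 0 1 0 0 \<in> imag_units"
    by (simp add: imag_units_iff norm_quat_def inner_quat_def)
  then have "\<exists>I\<in>imag_units. q \<in> P I" if "q \<in> \<Omega>" for q
    using that quat_in_slice[of "Quat 0 1 0 0" q] unfolding P_def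
    by (metis image_eqI vimageI)
  moreover have "P I \<subseteq> \<Omega>" for I by (auto simp: P_def)
  ultimately have "\<Omega> = \<Union> (P ` imag_units)" by blast
  moreover have "connected (\<Union> (P ` imag_units))"
    by (rule connected_Union) (use c a in blast)+
  ultimately have "connected \<Omega>" by simp
  moreover have "openin (top_of_set (slice_plane I)) (P I)" for I
    using assms(1) by (metis P openin_open_Int inf_commute)
  ultimately show ?thesis
    unfolding slice_domain_def P using assms a c by (blast intro: Reals_of_real)
qed

text \<open>The quaternions whose representative in the closed upper half plane lies in \<open>T\<close>, together with
  those nonreal ones whose representative lies in \<open>V\<close> and whose unit is at distance less than \<open>\<eta>\<close>
  from \<open>J\<close>. The distance condition is multiplied by the norm of the imaginary part, which makes
  it an open condition on all quaternions and excludes the real ones. If \<open>J\<close> is a unit and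
  \<open>\<eta> > 2\<close>, it holds at all nonreal points.\<close>

definition slice_tube :: "complex set \<Rightarrow> complex set \<Rightarrow> quat \<Rightarrow> real \<Rightarrow> quat set" where
  "slice_tube T V J \<eta> = {q. sphere_coord q \<in> T \<or> sphere_coord q \<in> V \<and>
     norm (quat_im q - norm (quat_im q) *\<^sub>R J) < \<eta> * norm (quat_im q)}"

lemma open_slice_tube:
  assumes "open T" "open V"
  shows "open (slice_tube T V J \<eta>)"
proof -
  have "slice_tube T V J \<eta> = sphere_coord -` T \<union> (sphere_coord -` V \<inter>
     {q. norm (quat_im q - norm (quat_im q) *\<^sub>R J) < \<eta> * norm (quat_im q)})"
    by (auto simp: slice_tube_def)
  also have "open \<dots>"
    using assms by (intro open_Un open_Int open_vimage open_Collect_less) (auto intro!: continuous_intros)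
  finally show ?thesis .
qed

lemma slice_emb_in_slice_tube_upper:
  assumes "I \<in> imag_units" "Im z \<ge> 0" "V \<subseteq> {z. Im z > 0}"
  shows "slice_emb I z \<in> slice_tube T V J \<eta> \<longleftrightarrow> z \<in> T \<or> z \<in> V \<and> norm (I - J) < \<eta>"
proof -
  have "norm (Im z *\<^sub>R I - Im z *\<^sub>R J) = Im z * norm (I - J)"
    using assms(2) by (simp flip: scaleR_diff_right)
  moreover have "norm I = 1" using assms(1) by (simp add: imag_units_iff)
  ultimately show ?thesis
    using assms by (auto simp: slice_tube_def quat_im_slice_emb sphere_coord_slice_emb)
qed

lemma slice_emb_in_slice_tube:
  assumes "I \<in> imag_units" "V \<subseteq> {z. Im z > 0}" "\<And>z. cnj z \<in> T \<longleftrightarrow> z \<in> T"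
  shows "slice_emb I z \<in> slice_tube T V J \<eta> \<longleftrightarrow>
    z \<in> T \<or> z \<in> V \<and> norm (I - J) < \<eta> \<or> cnj z \<in> V \<and> norm (- I - J) < \<eta>"
proof (cases "Im z \<ge> 0")
  case True
  then show ?thesis
    using slice_emb_in_slice_tube_upper[OF assms(1) True assms(2)] assms(2) by auto
next
  case False
  have "slice_emb I z = slice_emb (- I) (cnj z)" by (simp add: slice_emb_def)
  moreover have "slice_emb (- I) (cnj z) \<in> slice_tube T V J \<eta> \<longleftrightarrow>
      cnj z \<in> T \<or> cnj z \<in> V \<and> norm (- I - J) < \<eta>"
    using False by (intro slice_emb_in_slice_tube_upper imag_units_uminus assms) auto
  ultimately show ?thesis using False assms(2,3) by auto
qed

lemma slice_domain_slice_tube: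
  assumes "open T" "open V" "V \<subseteq> {z. Im z > 0}" "\<And>z. cnj z \<in> T \<longleftrightarrow> z \<in> T"
    and "connected T" "connected (T \<union> V)" "complex_of_real a \<in> T"
  shows "slice_domain (slice_tube T V J \<eta>)"
proof (rule slice_domainI)
  show "open (slice_tube T V J \<eta>)" using assms by (intro open_slice_tube)
  have "quat_im (of_real a) = 0" "sphere_coord (of_real a) = of_real a"
    by (simp_all add: quat_im_def sphere_coord_def of_real_quat complex_eq_iff)
  then show "of_real a \<in> slice_tube T V J \<eta>" using assms(7) by (simp add: slice_tube_def)
next
  fix I assume I: "I \<in> imag_units"
  have "cnj ` T = T" using assms(4) complex_cnj_cnj by (force simp: image_iff)
  then have "cnj ` (T \<union> V) = T \<union> cnj ` V" by (simp add: image_Un)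
  moreover have "connected (cnj ` (T \<union> V))"
    by (intro connected_continuous_image continuous_intros assms)
  ultimately have "connected (T \<union> cnj ` V)" by simp
  then have "connected ((T \<union> (if norm (I - J) < \<eta> then V else {})) \<union>
      (T \<union> (if norm (- I - J) < \<eta> then cnj ` V else {})))"
    using assms(5-7) by (intro connected_Un[of "T \<union> _"]) auto
  moreover have cnj_V: "z \<in> cnj ` V \<longleftrightarrow> cnj z \<in> V" for z
    by (metis complex_cnj_cnj imageE image_eqI)
  moreover have "slice_emb I -` slice_tube T V J \<eta> =
      (T \<union> (if norm (I - J) < \<eta> then V else {})) \<union>
      (T \<union> (if norm (- I - J) < \<eta> then cnj ` V else {}))"
    using slice_emb_in_slice_tube[OF I assms(3,4)] cnj_V by auto
  ultimately show "connected (slice_emb I -` slice_tube T V J \<eta>)" by simp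
qed

lemma axially_symmetric_slice_tube:
  assumes J: "J \<in> imag_units" and V: "V \<subseteq> {z. Im z > 0}" and "\<eta> > 2"
  shows "axially_symmetric (slice_tube T V J \<eta>)"
proof -
  have *: "slice_emb I z \<in> slice_tube T V J \<eta> \<longleftrightarrow> Complex (Re z) \<bar>Im z\<bar> \<in> T \<union> V"
    if I: "I \<in> imag_units" for I z
  proof -
    have "Im z \<noteq> 0" if "Complex (Re z) \<bar>Im z\<bar> \<in> V" using V that by auto
    moreover have "norm (Im z *\<^sub>R I - \<bar>Im z\<bar> *\<^sub>R J) < \<eta> * \<bar>Im z\<bar>" if "Im z \<noteq> 0"
    proof -
      have "norm (Im z *\<^sub>R I - \<bar>Im z\<bar> *\<^sub>R J) \<le> norm (Im z *\<^sub>R I) + norm (\<bar>Im z\<bar> *\<^sub>R J)"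
        by (rule norm_triangle_ineq4)
      also have "\<dots> = 2 * \<bar>Im z\<bar>" using I J by (simp add: imag_units_iff)
      also have "\<dots> < \<eta> * \<bar>Im z\<bar>" using that \<open>\<eta> > 2\<close> by simp
      finally show ?thesis .
    qed
    moreover have "norm I = 1" using I by (simp add: imag_units_iff)
    ultimately show ?thesis
      using I by (auto simp: slice_tube_def quat_im_slice_emb sphere_coord_slice_emb)
  qed
  show ?thesis
    unfolding axially_symmetric_def slice_emb_Complex[symmetric] using * by auto
qed

text \<open>Balls centred on a connected set that they cover have a connected union.\<close>

lemma connected_Union_balls:
  assumes "connected K" "K \<noteq> {}" "A \<subseteq> K" "K \<subseteq> (\<Union>a\<in>A. ball a (r a))" "\<And>a. a \<in> A \<Longrightarrow> r a > 0"
  shows "connected (\<Union>a\<in>A. ball a (r a) :: 'a :: real_normed_vector set)"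
proof -
  have "(\<Union>a\<in>A. ball a (r a)) = \<Union> ((\<lambda>a. K \<union> ball a (r a)) ` A)"
    using assms(2,4) by auto
  moreover have "connected (\<Union> ((\<lambda>a. K \<union> ball a (r a)) ` A))"
  proof (rule connected_Union)
    fix S assume "S \<in> (\<lambda>a. K \<union> ball a (r a)) ` A"
    then obtain a where a: "a \<in> A" "S = K \<union> ball a (r a)" by blast
    then have "a \<in> K \<inter> ball a (r a)" using assms(3,5) by auto
    then show "connected S" unfolding a(2) using assms(1) by (intro connected_Un) auto
  qed (use assms(2) in auto)
  ultimately show ?thesis by simp
qed

section \<open>Local extension along a planar continuum\<close>

text \<open>The extension step. The connected set \<open>T \<union> V\<close> carries the identity principle from the real
  points of \<open>T\<close> to the copies of \<open>V\<close>. The number \<open>3\<close> stands for any number above \<open>2\<close>, for which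
  the copies of \<open>V\<close> on all half planes are included.\<close>

lemma extension_triplet_slice_tube:
  assumes \<Omega>: "slice_domain \<Omega>" and f: "slice_regular f \<Omega>"
    and J: "J \<in> imag_units" and K: "K \<in> imag_units" "K \<noteq> J" "norm (K - J) < \<eta>"
    and T: "open T" "connected T" "complex_of_real a \<in> T" "\<And>z. cnj z \<in> T \<longleftrightarrow> z \<in> T"
    and V: "open V" "V \<subseteq> {z. Im z > 0}" and TV: "connected (T \<union> V)"
    and T_sub: "\<And>I z. I \<in> imag_units \<Longrightarrow> z \<in> T \<Longrightarrow> slice_emb I z \<in> \<Omega>"
    and V_sub: "\<And>I z. I \<in> imag_units \<Longrightarrow> norm (I - J) < \<eta> \<Longrightarrow> z \<in> V \<Longrightarrow> slice_emb I z \<in> \<Omega>"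
  shows "extension_triplet f \<Omega> (regular_ext f J K) (slice_tube T V J 3) (slice_tube T V J \<eta>)"
proof -
  define g where "g = regular_ext f J K"
  have "open \<Omega>" using \<Omega> by (simp add: slice_domain_def)
  then have sd: "slice_differentiable I (\<lambda>w. f (slice_emb I w)) z"
    if "I \<in> imag_units" "slice_emb I z \<in> \<Omega>" for I z
    using f that by (simp add: slice_regular_iff)
  have "\<eta> > 0" using K(3) by (meson norm_ge_zero order_le_less_trans)
  have upper: "Im z > 0" if "z \<in> V" for z using V(2) that by blast

  \<comment> \<open>The representation formula is applied on \<open>T\<close> for an arbitrary unit \<open>I\<close>, and on \<open>T \<union> V\<close> for a
     unit close to \<open>J\<close>, where \<open>f\<close> is defined on the whole copy of that set.\<close>
  have g_upper: "g (slice_emb I z) = f (slice_emb I z)"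
    if I: "I \<in> imag_units" and z: "Im z \<ge> 0" "z \<in> T \<or> z \<in> V \<and> norm (I - J) < \<eta>" for I z
  proof (cases "z \<in> T")
    case True
    show ?thesis unfolding g_def
    proof (rule regular_ext_eq[OF I J K(1) K(2)[symmetric] T(1-3) _ True z(1)])
      show "slice_differentiable L (\<lambda>w. f (slice_emb L w)) z" if "L \<in> {I, J, K}" "z \<in> T" for L z
        using that I J K by (intro sd T_sub) auto
    qed
  next
    case False
    then have near: "norm (I - J) < \<eta>" and zTV: "z \<in> T \<union> V" using z by auto
    show ?thesis unfolding g_def
    proof (rule regular_ext_eq[OF I J K(1) K(2)[symmetric] _ TV _ _ zTV z(1)])
      show "slice_differentiable L (\<lambda>w. f (slice_emb L w)) z"
        if "L \<in> {I, J, K}" "z \<in> T \<union> V" for L z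
      proof -
        have "L \<in> imag_units" "norm (L - J) < \<eta>"
          using that(1) I J K near \<open>\<eta> > 0\<close> by auto
        then show ?thesis using that(2) by (intro sd) (auto intro: T_sub V_sub)
      qed
    qed (use T V in auto)
  qed
  have g_T: "g (slice_emb I z) = f (slice_emb I z)" if I: "I \<in> imag_units" and z: "z \<in> T" for I z
  proof (cases "Im z \<ge> 0")
    case True
    then show ?thesis using g_upper I z by blast
  next
    case False
    then have "g (slice_emb (- I) (cnj z)) = f (slice_emb (- I) (cnj z))"
      using I z T(4) by (intro g_upper imag_units_uminus) auto
    then show ?thesis by (simp add: slice_emb_uminus)
  qed

  have sd_T: "slice_differentiable I (\<lambda>w. g (slice_emb I w)) z"
    if "I \<in> imag_units" "z \<in> T" for I z
    by (rule slice_differentiable_transform[OF sd T(1)]) (use that g_T T_sub in auto)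
  have sd_V: "slice_differentiable I (\<lambda>w. g (slice_emb I w)) z"
    if I: "I \<in> imag_units" and z: "z \<in> V" for I z
  proof (rule slice_differentiable_transform[OF slice_differentiable_rep V(1) z])
    show "rep_coeff J K I * f (slice_emb J w) + rep_coeff K J I * f (slice_emb K w) = g (slice_emb I w)"
      if "w \<in> V" for w
      using regular_ext_upper[OF I upper[OF that]] by (simp add: g_def)
    show "slice_differentiable J (\<lambda>w. f (slice_emb J w)) z"
      "slice_differentiable K (\<lambda>w. f (slice_emb K w)) z"
      using J K z \<open>\<eta> > 0\<close> by (auto intro!: sd V_sub)
  qed (use I J K in auto)
  have "slice_regular g (slice_tube T V J 3)"
    unfolding slice_regular_iff[OF open_slice_tube[OF T(1) V(1)]]
  proof (intro ballI allI impI)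
    fix I z assume I: "I \<in> imag_units" and "slice_emb I z \<in> slice_tube T V J 3"
    then consider "z \<in> T" | "z \<in> V" | "cnj z \<in> V"
      using slice_emb_in_slice_tube[OF I V(2) T(4)] by blast
    then show "slice_differentiable I (\<lambda>w. g (slice_emb I w)) z"
    proof cases
      case 3
      \<comment> \<open>On the lower half plane of \<open>I\<close>, which is the upper one of \<open>- I\<close>.\<close>
      have "slice_differentiable I (\<lambda>w. g (slice_emb (- I) (cnj w))) z"
        using sd_V[OF imag_units_uminus[OF I] 3] by (rule slice_differentiable_cnj)
      then show ?thesis by (simp add: slice_emb_uminus)
    qed (use sd_T sd_V I in auto)
  qed
  moreover have "slice_domain (slice_tube T V J \<eta>')" for \<eta>'
    using T V TV by (intro slice_domain_slice_tube)
  moreover have "axially_symmetric (slice_tube T V J 3)"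
    using J V(2) by (intro axially_symmetric_slice_tube) auto
  moreover have "slice_tube T V J 3 \<inter> \<real> \<subseteq> \<Omega>"
  proof
    fix q assume q: "q \<in> slice_tube T V J 3 \<inter> \<real>"
    then obtain x where x: "q = slice_emb J (of_real x)"
      by (auto simp: slice_emb_of_real elim: Reals_cases)
    then have "complex_of_real x \<in> T"
      using q slice_emb_in_slice_tube_upper[OF J _ V(2)] upper by fastforce
    then show "q \<in> \<Omega>" using x J T_sub by blast
  qed
  moreover have "q \<in> \<Omega> \<inter> slice_tube T V J 3 \<and> f q = g q" if "q \<in> slice_tube T V J \<eta>" for q
  proof -
    define z where "z = sphere_coord q"
    obtain I where I: "I \<in> imag_units" "q = slice_emb I z"
      using quat_in_slice[OF J] unfolding z_def by blast
    have "Im z \<ge> 0" by (simp add: z_def sphere_coord_def)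
    note tube = slice_emb_in_slice_tube_upper[OF I(1) this V(2)]
    have z: "z \<in> T \<or> z \<in> V \<and> norm (I - J) < \<eta>" using that tube I(2) by simp
    have "norm (I - J) \<le> norm I + norm J" by (rule norm_triangle_ineq4)
    then have "norm (I - J) < 3" using I J by (simp add: imag_units_iff)
    then have "q \<in> slice_tube T V J 3" using z tube I(2) by auto
    moreover have "q \<in> \<Omega>" using z I T_sub V_sub by blast
    moreover have "g q = f q" using g_upper[OF I(1) \<open>Im z \<ge> 0\<close> z] I(2) by simp
    ultimately show ?thesis by simp
  qed
  ultimately show ?thesis
    unfolding extension_triplet_def g_def[symmetric] by (intro conjI ballI subsetI) auto
qed

text \<open>Discs around the real points of \<open>K\<close> form \<open>T\<close>. What remains of \<open>K\<close> is compact in the open half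
  plane, and discs around its points form \<open>V\<close>. Since each disc is centred on \<open>K\<close>, the union
  \<open>T \<union> V\<close> inherits connectedness from \<open>K\<close>, as \<open>T\<close> does from the interval.\<close>

lemma planar_neighbourhoods:
  assumes \<Omega>: "open \<Omega>" and J: "J \<in> imag_units"
    and K: "compact K" "connected K" "K \<subseteq> {z. Im z \<ge> 0}" "slice_emb J ` K \<subseteq> \<Omega>"
    and R: "a \<le> b" "K \<inter> \<real> = complex_of_real ` {a..b}"
  obtains T V \<eta> where
    "open T" "connected T" "complex_of_real a \<in> T" "\<forall>z. cnj z \<in> T \<longleftrightarrow> z \<in> T"
    "open V" "V \<subseteq> {z. Im z > 0}" "connected (T \<union> V)" "K \<subseteq> T \<union> V" "\<eta> > 0"
    "\<forall>I\<in>imag_units. slice_emb I ` T \<subseteq> \<Omega>"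
    "\<forall>I\<in>imag_units. norm (I - J) < \<eta> \<longrightarrow> slice_emb I ` V \<subseteq> \<Omega>"
proof -
  define R where "R = complex_of_real ` {a..b}"
  have R_K: "R \<subseteq> K" and a_R: "of_real a \<in> R" and "connected R" "compact R"
    using R by (auto simp: R_def intro!: connected_continuous_image compact_continuous_image continuous_intros)
  have "compact (slice_emb J ` R)" "slice_emb J ` R \<subseteq> \<Omega>"
    using \<open>compact R\<close> R_K K(4) by (auto intro!: compact_continuous_image continuous_intros)
  then obtain r where r: "r > 0" "(\<Union>p\<in>slice_emb J ` R. ball p r) \<subseteq> \<Omega>"
    using compact_subset_open_imp_ball_epsilon_subset \<Omega> by metis
  define T where "T = (\<Union>x\<in>R. ball x r)"
  have "open T" unfolding T_def by blast
  have "R \<subseteq> T" using r(1) by (auto simp: T_def)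

  define A where "A = K - T"
  have "compact A" using K(1) \<open>open T\<close> by (simp add: A_def compact_diff)
  \<comment> \<open>A uniform radius around the compact set \<open>A \<times> {J}\<close> inside the open set \<open>W\<close> of pairs of a point
     and a unit bounds at once the discs of \<open>V\<close> and the distance of the units from \<open>J\<close>.\<close>
  define W where "W = {p :: complex \<times> quat. Im (fst p) > 0 \<and> slice_emb (snd p) (fst p) \<in> \<Omega>}"
  have "open W"
  proof -
    have "W = {p. 0 < Im (fst p)} \<inter> (\<lambda>p. slice_emb (snd p) (fst p)) -` \<Omega>"
      by (auto simp: W_def)
    moreover have "open {p :: complex \<times> quat. 0 < Im (fst p)}"
      by (intro open_Collect_less continuous_intros)
    moreover have "open ((\<lambda>p :: complex \<times> quat. slice_emb (snd p) (fst p)) -` \<Omega>)"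
      unfolding slice_emb_def using \<Omega> by (intro open_vimage) (auto intro!: continuous_intros)
    ultimately show ?thesis by auto
  qed
  moreover have "A \<times> {J} \<subseteq> W"
  proof -
    have "Im z > 0" if "z \<in> A" for z
    proof -
      have "z \<notin> \<real>" using that R \<open>R \<subseteq> T\<close> by (auto simp: A_def R_def)
      then show ?thesis
        using that K(3) by (auto simp: A_def complex_is_Real_iff less_le)
    qed
    then show ?thesis using K(4) by (auto simp: W_def A_def)
  qed
  moreover have "compact (A \<times> {J})" using \<open>compact A\<close> by (intro compact_Times) auto
  ultimately obtain e where e: "e > 0" "(\<Union>p\<in>A \<times> {J}. ball p e) \<subseteq> W"
    using compact_subset_open_imp_ball_epsilon_subset by metis
  define V where "V = (\<Union>x\<in>A. ball x (e / 2))"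
  have W: "(z, I) \<in> W" if "z \<in> V" "norm (I - J) < e / 2" for z I
  proof -
    from that obtain x where x: "x \<in> A" "dist x z < e / 2" by (auto simp: V_def)
    have "dist (x, J) (z, I) \<le> dist x z + dist J I"
      unfolding dist_Pair_Pair by (rule sqrt_sum_squares_le_sum) auto
    then have "(z, I) \<in> ball (x, J) e" using x that(2) by (simp add: dist_norm norm_minus_commute)
    then show ?thesis using e(2) x(1) by blast
  qed

  show ?thesis
  proof (rule that[of T V "e / 2"])
    show "connected T"
      unfolding T_def by (rule connected_Union_balls[OF \<open>connected R\<close>]) (use r a_R in auto)
    show "K \<subseteq> T \<union> V" using e(1) by (auto simp: V_def A_def)
    have "T \<union> V = (\<Union>x\<in>R \<union> A. if x \<in> R then ball x r else ball x (e / 2))"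
      using \<open>R \<subseteq> T\<close> unfolding T_def V_def by (auto simp: A_def T_def)
    also have "\<dots> = (\<Union>x\<in>R \<union> A. ball x (if x \<in> R then r else e / 2))"
      by (intro SUP_cong) auto
    finally have TV: "T \<union> V = (\<Union>x\<in>R \<union> A. ball x (if x \<in> R then r else e / 2))" .
    show "connected (T \<union> V)"
      unfolding TV
    proof (rule connected_Union_balls[OF K(2)])
      show "K \<subseteq> (\<Union>x\<in>R \<union> A. ball x (if x \<in> R then r else e / 2))"
        using \<open>K \<subseteq> T \<union> V\<close> TV by simp
    qed (use r e R_K a_R in \<open>auto simp: A_def\<close>)
    show "\<forall>z. cnj z \<in> T \<longleftrightarrow> z \<in> T"
    proof -
      have "dist x (cnj z) = dist x z" if "x \<in> R" for x z
      proof -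
        have "cnj x = x" using that by (auto simp: R_def)
        then show ?thesis by (metis complex_cnj_diff complex_mod_cnj dist_norm)
      qed
      then show ?thesis by (auto simp: T_def)
    qed
    show "\<forall>I\<in>imag_units. slice_emb I ` T \<subseteq> \<Omega>"
    proof safe
      fix I z assume I: "I \<in> imag_units" and z: "z \<in> T"
      obtain x where x: "x \<in> R" "dist x z < r" using z by (auto simp: T_def)
      then have "slice_emb J x = slice_emb I x" by (auto simp: R_def slice_emb_of_real)
      then have "slice_emb I z \<in> ball (slice_emb J x) r"
        using x(2) dist_slice_emb[OF I] by simp
      then show "slice_emb I z \<in> \<Omega>" using r(2) x(1) by blast
    qed
    show "\<forall>I\<in>imag_units. norm (I - J) < e / 2 \<longrightarrow> slice_emb I ` V \<subseteq> \<Omega>"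
      using W by (auto simp: W_def)
    show "V \<subseteq> {z. Im z > 0}"
    proof
      fix z assume "z \<in> V"
      then have "(z, J) \<in> W" using W e(1) by simp
      then show "z \<in> {z. Im z > 0}" by (simp add: W_def)
    qed
    show "open V" unfolding V_def by blast
  qed (use \<open>open T\<close> \<open>R \<subseteq> T\<close> a_R e in auto)
qed

text \<open>A path from \<open>K\<close> to the real point \<open>x\<close> is followed up to its first real point \<open>c\<close>.\<close>

lemma continuum_reaching_reals:
  assumes S: "open S" "connected S" and x: "complex_of_real x \<in> S"
    and K: "compact K" "connected K" "K \<noteq> {}" "K \<subseteq> S" "K \<subseteq> {z. Im z > 0}"
  obtains L c where "compact L" "connected L" "K \<subseteq> L" "L \<subseteq> S" "L \<subseteq> {z. Im z \<ge> 0}"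
    "L \<inter> \<real> = {complex_of_real c}"
proof -
  obtain w where w: "w \<in> K" using K(3) by blast
  have "path_connected S" using S by (simp add: connected_open_path_connected)
  then obtain p where p: "path p" "path_image p \<subseteq> S" "pathstart p = w" "pathfinish p = of_real x"
    using w x K(4) unfolding path_connected_def by blast
  let ?H = "{z. Im z > 0}"
  have "open ?H" by (simp add: open_halfspace_Im_gt)
  have "frontier ?H = {z. Im z = 0}"
  proof -
    have "?H = {z. inner \<i> z > 0}" by (simp add: inner_complex_def)
    moreover have "frontier {z. inner \<i> z > 0} = {z. inner \<i> z = 0}"
      by (rule frontier_halfspace_gt) simp
    ultimately show ?thesis by (simp add: inner_complex_def)
  qed
  moreover have "pathstart p \<in> closure ?H" using p(3) w K(5) closure_subset by blast
  moreover have "pathfinish p \<notin> ?H" using p(4) by simp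
  ultimately obtain h where h: "path h" "pathstart h = w" "path_image h \<subseteq> path_image p"
    "path_image h - {pathfinish h} \<subseteq> ?H" "Im (pathfinish h) = 0"
    using exists_path_subpath_to_frontier[OF p(1), of ?H] p(3) interior_open[OF \<open>open ?H\<close>]
    by (metis mem_Collect_eq)
  define c where "c = Re (pathfinish h)"
  have c: "pathfinish h = of_real c" using h(5) by (simp add: c_def complex_eq_iff)
  have in_h: "w \<in> path_image h" "of_real c \<in> path_image h"
    using h(2) c by (metis pathstart_in_path_image) (metis c pathfinish_in_path_image)
  show ?thesis
  proof
    show "compact (K \<union> path_image h)"
      using K(1) h(1) by (simp add: compact_Un compact_path_image)
    show "connected (K \<union> path_image h)"
      using K(2) h(1) w in_h by (intro connected_Un connected_path_image) auto
    show "K \<union> path_image h \<subseteq> {z. Im z \<ge> 0}" using h(4) K(5) c by force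
    show "(K \<union> path_image h) \<inter> \<real> = {complex_of_real c}"
      using h(4) K(5) c in_h by (force simp: complex_is_Real_iff)
  qed (use K(4) h p in auto)
qed

section \<open>Extension near a symmetric continuum\<close>

text \<open>Taking the closure of the part of a closed set on a half plane adds at most real points of the
  set.\<close>

lemma closure_Int_half_plane:
  assumes "closed C" and J: "J \<in> imag_units" and q: "q \<in> closure (C \<inter> half_plane J)"
  shows "q \<in> C" "q = slice_emb J (sphere_coord q)"
proof -
  have "C \<inter> half_plane J \<subseteq> C \<inter> {q. q = slice_emb J (sphere_coord q)}"
    using J by (auto simp: half_plane_eq sphere_coord_slice_emb)
  moreover have "closed (C \<inter> {q. q = slice_emb J (sphere_coord q)})"
    using assms(1) by (intro closed_Int closed_Collect_eq continuous_intros)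
  ultimately have "closure (C \<inter> half_plane J) \<subseteq> C \<inter> {q. q = slice_emb J (sphere_coord q)}"
    by (rule closure_minimal)
  then show "q \<in> C" "q = slice_emb J (sphere_coord q)" using q by auto
qed

lemma axially_symmetric_slice_emb:
  assumes C: "axially_symmetric C" and J: "J \<in> imag_units" and q: "q \<in> C"
  shows "slice_emb J (sphere_coord q) \<in> C"
proof -
  obtain I where I: "I \<in> imag_units" "q = slice_emb I (sphere_coord q)"
    using quat_in_slice[OF J] by blast
  then have "of_real (Re (sphere_coord q)) + Im (sphere_coord q) *\<^sub>R I \<in> C"
    using q by (simp add: slice_emb_def)
  then have "of_real (Re (sphere_coord q)) + Im (sphere_coord q) *\<^sub>R J \<in> C"
    using C I(1) J unfolding axially_symmetric_def by blast
  then show ?thesis by (simp add: slice_emb_def)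
qed

lemma connected_vimage_slice_emb:
  assumes "slice_domain \<Omega>" and J: "J \<in> imag_units"
  shows "connected (slice_emb J -` \<Omega>)"
proof -
  have *: "Complex (qRe (slice_emb J z)) (inner (slice_emb J z) J) = z" for z
  proof -
    have "inner J J = 1" "qRe J = 0" using J by (auto simp: imag_units_iff dot_square_norm)
    then show ?thesis
      by (simp add: slice_emb_def inner_add_left of_real_quat complex_eq_iff)
        (simp add: inner_quat_def)
  qed
  have "connected (\<Omega> \<inter> slice_plane J)" using assms by (simp add: slice_domain_def)
  then have "connected ((\<lambda>q. Complex (qRe q) (inner q J)) ` (\<Omega> \<inter> slice_plane J))"
    unfolding Complex_eq by (intro connected_continuous_image continuous_intros)
  also have "(\<lambda>q. Complex (qRe q) (inner q J)) ` (\<Omega> \<inter> slice_plane J) = slice_emb J -` \<Omega>"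
  proof (intro equalityI subsetI)
    fix z assume "z \<in> slice_emb J -` \<Omega>"
    then show "z \<in> (\<lambda>q. Complex (qRe q) (inner q J)) ` (\<Omega> \<inter> slice_plane J)"
      unfolding slice_plane_eq by (intro image_eqI[where x = "slice_emb J z"]) (auto simp: *)
  qed (auto simp: slice_plane_eq *)
  finally show ?thesis .
qed

text \<open>The planar set represented by \<open>C\<close> is compact and connected, and its copy on the half plane of
  \<open>J\<close> lies in \<open>\<Omega>\<close>. It already meets the real line in an interval, or it is joined to a real
  point, which is then a degenerate interval, by a path in the slice of \<open>J\<close>.\<close>

lemma planar_continuum:
  assumes \<Omega>: "slice_domain \<Omega>" and J: "J \<in> imag_units"
    and C: "axially_symmetric C" "compact C" "connected C" "C \<noteq> {}" "C \<inter> half_plane J \<subseteq> \<Omega>"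
    and real: "C \<inter> \<real> \<noteq> {} \<Longrightarrow>
      (\<exists>a b :: real. a \<le> b \<and> C \<inter> \<real> = of_real ` {a..b}) \<and> C \<inter> \<real> \<subseteq> \<Omega>"
  obtains K a b where "compact K" "connected K" "sphere_coord ` C \<subseteq> K"
    "K \<subseteq> {z. Im z \<ge> 0}" "slice_emb J ` K \<subseteq> \<Omega>" "a \<le> b" "K \<inter> \<real> = complex_of_real ` {a..b}"
proof -
  define K where "K = sphere_coord ` C"
  have K: "compact K" "connected K" "K \<noteq> {}" "K \<subseteq> {z. Im z \<ge> 0}"
    using C by (auto simp: K_def sphere_coord_def[of q for q] intro!: compact_continuous_image
        connected_continuous_image continuous_intros)
  have K_C: "slice_emb J z \<in> C \<longleftrightarrow> z \<in> K" if "Im z \<ge> 0" for z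
  proof
    assume "slice_emb J z \<in> C"
    then show "z \<in> K"
      using that J unfolding K_def by (intro image_eqI) (auto simp: sphere_coord_slice_emb complex_eq_iff)
  next
    assume "z \<in> K"
    then show "slice_emb J z \<in> C"
      using C(1) J axially_symmetric_slice_emb by (auto simp: K_def)
  qed
  have K_\<Omega>: "slice_emb J z \<in> \<Omega>" if "z \<in> K" for z
  proof -
    have z: "Im z \<ge> 0" "slice_emb J z \<in> C" using that K(4) K_C by auto
    show ?thesis
    proof (cases "Im z = 0")
      case True
      then show ?thesis using z Reals_slice_emb[OF J] real by blast
    next
      case False
      then show ?thesis using z C(5) by (auto simp: half_plane_eq)
    qed
  qed
  have K_real: "complex_of_real x \<in> K \<longleftrightarrow> of_real x \<in> C" for x
    using K_C[of "of_real x"] by (simp add: slice_emb_of_real)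
  show ?thesis
  proof (cases "C \<inter> \<real> = {}")
    case False
    then obtain a b :: real where ab: "a \<le> b" "C \<inter> \<real> = of_real ` {a..b}" using real by blast
    have "of_real x \<in> C \<longleftrightarrow> x \<in> {a..b}" for x
    proof -
      have "of_real x \<in> C \<longleftrightarrow> (of_real x :: quat) \<in> of_real ` {a..b}" using ab(2) Reals_of_real by blast
      then show ?thesis by (auto simp: image_iff)
    qed
    then have "K \<inter> \<real> = complex_of_real ` {a..b}"
      using K_real by (auto elim!: Reals_cases)
    moreover have "slice_emb J ` K \<subseteq> \<Omega>" using K_\<Omega> by blast
    ultimately show ?thesis using that[of K a b] K ab(1) by (simp add: K_def)
  next
    case True
    have "Im z \<noteq> 0" if "z \<in> K" for z
    proof
      assume "Im z = 0"
      then have "z = of_real (Re z)" by (simp add: complex_eq_iff)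
      then have "of_real (Re z) \<in> C" using that K_real by metis
      then show False using True by auto
    qed
    then have pos: "K \<subseteq> {z. Im z > 0}" using K(4) by force
    obtain x where x: "of_real x \<in> \<Omega>"
      using \<Omega> unfolding slice_domain_def by (auto elim: Reals_cases)
    have "open (slice_emb J -` \<Omega>)"
      using \<Omega> by (intro open_vimage) (auto simp: slice_domain_def intro!: continuous_intros)
    then obtain L c where "compact L" "connected L" "K \<subseteq> L" "L \<subseteq> slice_emb J -` \<Omega>"
      "L \<subseteq> {z. Im z \<ge> 0}" "L \<inter> \<real> = {complex_of_real c}"
    proof (rule continuum_reaching_reals[OF _ connected_vimage_slice_emb[OF \<Omega> J] _ K(1-3) _ pos])
      show "of_real x \<in> slice_emb J -` \<Omega>" using x by (simp add: slice_emb_of_real)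
      show "K \<subseteq> slice_emb J -` \<Omega>" using K_\<Omega> by blast
    qed
    moreover from this have "slice_emb J ` L \<subseteq> \<Omega>" by blast
    ultimately show ?thesis
      using that[of L c c] by (simp add: K_def)
  qed
qed

theorem theorem11p4:
  fixes f :: "quat \<Rightarrow> quat" and \<Omega> C :: "quat set" and J0 :: quat
  assumes "slice_domain \<Omega>" and "slice_regular f \<Omega>"
    and "J0 \<in> imag_units"
    and "axially_symmetric C" and "compact C" and "path_connected C"
    and "C \<inter> half_plane J0 \<noteq> {}"
    and "C \<inter> half_plane J0 \<subseteq> \<Omega> \<inter> half_plane J0"
    and "C \<inter> \<real> \<noteq> {} \<Longrightarrow>
      (\<exists>a b :: real. a \<le> b \<and> C \<inter> \<real> = of_real ` {a..b}) \<and> C \<inter> \<real> \<subseteq> \<Omega>"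
  shows "\<exists>(g :: quat \<Rightarrow> quat) N \<Lambda> (\<delta> :: real).
    extension_triplet f \<Omega> g N \<Lambda> \<and> \<delta> > 0 \<and>
    (\<Union>J\<in>{J \<in> imag_units. norm (J - J0) \<le> \<delta>}. closure (C \<inter> half_plane J)) \<subseteq> \<Lambda> \<and>
    (\<exists>U. open U \<and> closure (C \<inter> half_plane J0) \<subseteq> U \<and> U \<subseteq> \<Omega> \<inter> N \<and> (\<forall>q\<in>U. g q = f q))"
proof -
  have C: "connected C" "C \<noteq> {}" "C \<inter> half_plane J0 \<subseteq> \<Omega>"
    using assms(6-8) by (auto intro: path_connected_imp_connected)
  obtain K a b where K: "compact K" "connected K" "sphere_coord ` C \<subseteq> K"
    "K \<subseteq> {z. Im z \<ge> 0}" "slice_emb J0 ` K \<subseteq> \<Omega>" "a \<le> b" "K \<inter> \<real> = complex_of_real ` {a..b}"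
    by (rule planar_continuum[OF assms(1,3-5) C assms(9)])
  have "open \<Omega>" using assms(1) by (simp add: slice_domain_def)
  obtain T V \<eta> where T: "open T" "connected T" "complex_of_real a \<in> T" "\<forall>z. cnj z \<in> T \<longleftrightarrow> z \<in> T"
    and V: "open V" "V \<subseteq> {z. Im z > 0}" and TV: "connected (T \<union> V)" "K \<subseteq> T \<union> V" and "\<eta> > 0"
    and T_sub: "\<forall>I\<in>imag_units. slice_emb I ` T \<subseteq> \<Omega>"
    and V_sub: "\<forall>I\<in>imag_units. norm (I - J0) < \<eta> \<longrightarrow> slice_emb I ` V \<subseteq> \<Omega>"
    by (rule planar_neighbourhoods[OF \<open>open \<Omega>\<close> assms(3) K(1,2,4-7)])
  obtain J1 where J1: "J1 \<in> imag_units" "J1 \<noteq> J0" "norm (J1 - J0) < \<eta>"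
    using exists_close_imag_unit[OF assms(3) \<open>\<eta> > 0\<close>] .
  define g where "g = regular_ext f J0 J1"
  define N where "N = slice_tube T V J0 3"
  define \<Lambda> where "\<Lambda> = slice_tube T V J0 \<eta>"
  have triplet: "extension_triplet f \<Omega> g N \<Lambda>"
    unfolding g_def N_def \<Lambda>_def
    by (rule extension_triplet_slice_tube[OF assms(1-3) J1 T(1-3) _ V TV(1)])
      (use T(4) T_sub V_sub in blast)+
  have cover: "closure (C \<inter> half_plane J) \<subseteq> \<Lambda>"
    if J: "J \<in> imag_units" "norm (J - J0) \<le> \<eta> / 2" for J
  proof
    fix q assume "q \<in> closure (C \<inter> half_plane J)"
    from closure_Int_half_plane[OF compact_imp_closed[OF assms(5)] J(1) this]
    have q: "q \<in> C" "q = slice_emb J (sphere_coord q)" .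
    have "Im (sphere_coord q) \<ge> 0" by (simp add: sphere_coord_def)
    moreover have "sphere_coord q \<in> T \<union> V" using q(1) K(3) TV(2) by blast
    moreover have "norm (J - J0) < \<eta>" using J(2) \<open>\<eta> > 0\<close> by simp
    ultimately have "slice_emb J (sphere_coord q) \<in> \<Lambda>"
      unfolding \<Lambda>_def using slice_emb_in_slice_tube_upper[OF J(1) _ V(2)] by blast
    then show "q \<in> \<Lambda>" using q(2) by simp
  qed
  have "closure (C \<inter> half_plane J0) \<subseteq> \<Lambda>" using cover[OF assms(3)] \<open>\<eta> > 0\<close> by simp
  moreover have "open \<Lambda>" "\<Lambda> \<subseteq> \<Omega> \<inter> N" "\<forall>q\<in>\<Lambda>. g q = f q"
    using triplet by (auto simp: extension_triplet_def slice_domain_def)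
  ultimately have "\<exists>U. open U \<and> closure (C \<inter> half_plane J0) \<subseteq> U \<and> U \<subseteq> \<Omega> \<inter> N \<and>
      (\<forall>q\<in>U. g q = f q)"
    by blast
  moreover have "(\<Union>J\<in>{J \<in> imag_units. norm (J - J0) \<le> \<eta> / 2}. closure (C \<inter> half_plane J)) \<subseteq> \<Lambda>"
    using cover by (intro UN_least) simp
  moreover have "\<eta> / 2 > 0" using \<open>\<eta> > 0\<close> by simp
  ultimately show ?thesis
    using triplet by blast
qed

end
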